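(* Let $m\ge 4$ and let $n$ be an integer with $2^{m-1}+1-2^{\lfloor m/2\rfloor}\le n\le 2^{m-1}-1$. Then $$g(n,m)=2n+\left\lfloor \frac{2^{m-1}-1-n}{2}\right\rfloor.$$
   Context: Write $[m]=\{1,\ldots,m\}$. For a multiset $\mathcal{F}=\{C_1,\ldots,C_t\}$ of non-empty subsets of $[m]$ (repetitions allowed; members indexed by $[t]$), a resolution into $n$ classes is a partition $\{A_1,\ldots,A_n\}$ of $[t]$ into $n$ blocks such that for each $i$ the sets $C_j$, $j\in A_i$, are pairwise disjoint with union $[m]$. $\mathcal{F}$ is uniquely resolvable with respect to $(n,m)$ if it has exactly one resolution into $n$ classes (partitions regarded as unordered). $g(n,m)$ is the maximum size of a uniquely resolvable multiset with respect to $(n,m)$. *)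

theory Defs
  imports "HOL-Library.Multiset" "HOL-Library.Disjoint_Sets"
begin

definition indexing :: "'a multiset \<Rightarrow> (nat \<Rightarrow> 'a) \<Rightarrow> bool" where
  "indexing F C \<longleftrightarrow> image_mset C (mset_set {1..size F}) = F"

(* The index set {1..t}, not the multiset of sets itself, is partitioned: equal members
   at different positions are distinguishable, so exchanging them between two classes
   generally gives another resolution. *)
definition resolution ::
    "nat \<Rightarrow> nat \<Rightarrow> nat \<Rightarrow> (nat \<Rightarrow> nat set) \<Rightarrow> nat set set \<Rightarrow> bool" where
  "resolution n m t C P \<longleftrightarrow>
     partition_on {1..t} P \<and> card P = n \<and>
     (\<forall>A\<in>P. disjoint_family_on C A \<and> (\<Union>j\<in>A. C j) = {1..m})"

(* The choice of the indexing is immaterial: see uniquely_resolvable_iff below. *)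
definition uniquely_resolvable :: "nat \<Rightarrow> nat \<Rightarrow> nat set multiset \<Rightarrow> bool" where
  "uniquely_resolvable n m F \<longleftrightarrow>
     (\<forall>X\<in>#F. X \<noteq> {} \<and> X \<subseteq> {1..m}) \<and>
     (\<exists>C. indexing F C \<and> (\<exists>!P. resolution n m (size F) C P))"

definition g :: "nat \<Rightarrow> nat \<Rightarrow> nat" where
  "g n m = Max {size F | F. uniquely_resolvable n m F}"

lemma indexing_exists: "\<exists>C. indexing F C"
proof -
  obtain xs where xs: "mset xs = F" using ex_mset by blast
  have "map (\<lambda>i. xs ! (i - 1)) [1..<Suc (length xs)] = xs"
    by (intro nth_equalityI) (auto simp: nth_append simp del: upt_Suc)
  moreover have "mset [1..<Suc (length xs)] = mset_set {1..length xs}"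
    by (metis atLeastLessThanSuc_atLeastAtMost mset_upt)
  ultimately have "image_mset (\<lambda>i. xs ! (i - 1)) (mset_set {1..length xs}) = mset xs"
    by (metis mset_map)
  then show ?thesis
    using xs unfolding indexing_def by (metis size_mset)
qed

lemma indexing_permute:
  fixes F :: "'a multiset"
  assumes "indexing F C" "indexing F D"
  shows "\<exists>p. bij_betw p {1..size F} {1..size F} \<and> (\<forall>i\<in>{1..size F}. D (p i) = C i)"
proof -
  let ?I = "{1..size F}"
  have eq: "image_mset C (mset_set ?I) = image_mset D (mset_set ?I)"
    using assms by (simp add: indexing_def)
  have count_card: "count (image_mset f (mset_set ?I)) X = card {i \<in> ?I. f i = X}"
    for f :: "nat \<Rightarrow> 'a" and X
  proof -
    have "count (image_mset f (mset_set ?I)) X = (\<Sum>i | i \<in># mset_set ?I \<and> X = f i. count (mset_set ?I) i)"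
      by (rule count_image_mset')
    also have "\<dots> = (\<Sum>i \<in> {i \<in> ?I. f i = X}. 1)"
      by (rule sum.cong) auto
    finally show ?thesis by simp
  qed
  have card_eq: "card {i \<in> ?I. C i = X} = card {i \<in> ?I. D i = X}" for X
    using eq count_card[of C X] count_card[of D X] by argo
  have "\<exists>q. bij_betw q {i \<in> ?I. C i = X} {i \<in> ?I. D i = X}" for X
    using card_eq[of X] by (intro finite_same_card_bij) auto
  then have "\<forall>X. \<exists>q. bij_betw q {i \<in> ?I. C i = X} {i \<in> ?I. D i = X}" by blast
  from choice[OF this] obtain q
    where q: "\<And>X. bij_betw (q X) {i \<in> ?I. C i = X} {i \<in> ?I. D i = X}" by blast
  define p where "p i = q (C i) i" for i
  have p: "p i \<in> ?I \<and> D (p i) = C i" if "i \<in> ?I" for i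
    using bij_betwE[OF q[of "C i"]] that unfolding p_def by blast
  have "inj_on p ?I"
  proof (rule inj_onI)
    fix i j assume ij: "i \<in> ?I" "j \<in> ?I" "p i = p j"
    then have "C i = C j" using p by metis
    then show "i = j"
      using ij bij_betw_imp_inj_on[OF q[of "C i"]] unfolding p_def inj_on_def by auto
  qed
  moreover have "p ` ?I \<subseteq> ?I" using p by blast
  ultimately have "bij_betw p ?I ?I"
    by (simp add: bij_betw_def endo_inj_surj)
  then show ?thesis using p by blast
qed

lemma resolution_permute:
  assumes p: "bij_betw p {1..t} {1..t}" and CD: "\<And>i. i \<in> {1..t} \<Longrightarrow> D (p i) = C i"
    and P: "resolution n m t C P"
  shows "resolution n m t D ((`) p ` P)"
proof -
  have inj: "inj_on p {1..t}" and im: "p ` {1..t} = {1..t}"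
    using p by (auto simp: bij_betw_def)
  have part: "partition_on {1..t} P"
    and cls: "\<And>A. A \<in> P \<Longrightarrow> disjoint_family_on C A \<and> (\<Union>j\<in>A. C j) = {1..m}"
    and cd: "card P = n"
    using P by (auto simp: resolution_def)
  have sub: "A \<subseteq> {1..t}" if "A \<in> P" for A
    using that part by (auto simp: partition_on_def)
  have "partition_on (p ` {1..t}) ((`) p ` P - {{}})"
    using partition_on_inj_image[OF part inj] by simp
  moreover have "{} \<notin> (`) p ` P" using part by (auto simp: partition_on_def)
  ultimately have "partition_on {1..t} ((`) p ` P)" using im
    by (metis Diff_insert0 Diff_empty)
  moreover have "inj_on ((`) p) P"
    using sub by (intro inj_onI) (metis inj inj_on_image_eq_iff)
  then have "card ((`) p ` P) = n" using cd by (simp add: card_image)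
  moreover have "disjoint_family_on D (p ` A) \<and> (\<Union>j\<in>p ` A. D j) = {1..m}" if "A \<in> P" for A
  proof -
    have "\<And>i. i \<in> A \<Longrightarrow> D (p i) = C i" using sub[OF that] CD by blast
    then show ?thesis
      using cls[OF that] by (force simp: disjoint_family_on_def)
  qed
  ultimately show ?thesis unfolding resolution_def by blast
qed

lemma unique_resolution_permute:
  assumes p: "bij_betw p {1..t} {1..t}" and CD: "\<And>i. i \<in> {1..t} \<Longrightarrow> D (p i) = C i"
    and uq: "\<exists>!P. resolution n m t C P"
  shows "\<exists>!P. resolution n m t D P"
proof -
  let ?q = "the_inv_into {1..t} p"
  have inj: "inj_on p {1..t}" using p by (simp add: bij_betw_def)
  have q: "bij_betw ?q {1..t} {1..t}" using p by (rule bij_betw_the_inv_into)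
  have pq: "p (?q i) = i" if "i \<in> {1..t}" for i
    using that p by (metis bij_betw_def f_the_inv_into_f)
  have DC: "C (?q i) = D i" if "i \<in> {1..t}" for i
    using that CD[of "?q i"] pq[OF that] bij_betwE[OF q] by metis
  obtain P where P: "resolution n m t C P" "\<And>Q. resolution n m t C Q \<Longrightarrow> Q = P"
    using uq by blast
  show ?thesis
  proof (rule ex1I[of _ "(`) p ` P"])
    show "resolution n m t D ((`) p ` P)"
      using resolution_permute[OF p CD P(1)] .
  next
    fix Q assume Q: "resolution n m t D Q"
    have "(`) ?q ` Q = P"
      using resolution_permute[OF q DC Q] P(2) by simp
    moreover have "p ` ?q ` A = A" if "A \<in> Q" for A
    proof -
      have "A \<subseteq> {1..t}" using that Q by (auto simp: resolution_def partition_on_def)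
      then show ?thesis using pq by (force simp: image_image)
    qed
    ultimately show "Q = (`) p ` P" by (force simp: image_image)
  qed
qed

lemma uniquely_resolvable_iff:
  assumes C: "indexing F C"
  shows "uniquely_resolvable n m F \<longleftrightarrow>
    (\<forall>X\<in>#F. X \<noteq> {} \<and> X \<subseteq> {1..m}) \<and> (\<exists>!P. resolution n m (size F) C P)"
proof -
  have "\<exists>!P. resolution n m (size F) C P"
    if D: "indexing F D" and uq: "\<exists>!P. resolution n m (size F) D P" for D
  proof -
    obtain p where p: "bij_betw p {1..size F} {1..size F}"
      and CD: "\<forall>i\<in>{1..size F}. C (p i) = D i"
      using indexing_permute[OF D C] by blast
    show ?thesis
      by (rule unique_resolution_permute[OF p _ uq]) (rule bspec[OF CD])
  qed
  then have "(\<exists>C. indexing F C \<and> (\<exists>!P. resolution n m (size F) C P)) \<longleftrightarrow>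
      (\<exists>!P. resolution n m (size F) C P)"
    using C by iprover
  then show ?thesis unfolding uniquely_resolvable_def by (rule arg_cong)
qed

lemma size_le_if_uniquely_resolvable:
  assumes "uniquely_resolvable n m F"
  shows "size F \<le> n * m"
proof -
  let ?I = "{1..size F}"
  obtain C P where C: "indexing F C" and P: "resolution n m (size F) C P"
    and ne: "\<forall>X\<in>#F. X \<noteq> {}"
    using assms unfolding uniquely_resolvable_def by blast
  have part: "partition_on ?I P" and cd: "card P = n"
    and cls: "\<And>A. A \<in> P \<Longrightarrow> disjoint_family_on C A \<and> (\<Union>j\<in>A. C j) = {1..m}"
    using P by (auto simp: resolution_def)
  have C_ne: "C i \<noteq> {}" if "i \<in> ?I" for i
  proof -
    have "C i \<in># image_mset C (mset_set ?I)" using that by simp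
    then show ?thesis using ne C unfolding indexing_def by metis
  qed
  have card_le: "card A \<le> m" if A: "A \<in> P" for A
  proof -
    have sub: "A \<subseteq> ?I" using A part by (auto simp: partition_on_def)
    then have "\<forall>i\<in>A. \<exists>x. x \<in> C i" using C_ne by blast
    then obtain f where f: "\<And>i. i \<in> A \<Longrightarrow> f i \<in> C i" by metis
    have "inj_on f A"
      using f cls[OF A] unfolding inj_on_def disjoint_family_on_def
      by (metis IntI empty_iff)
    moreover have "f ` A \<subseteq> {1..m}" using f cls[OF A] by blast
    ultimately have "card A \<le> card {1..m}" by (intro card_inj_on_le) auto
    then show ?thesis by simp
  qed
  have "size F = card (\<Union>P)" using part by (simp add: partition_on_def)
  also have "\<dots> \<le> (\<Sum>A\<in>P. card A)" by (rule card_Union_le_sum_card)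
  also have "\<dots> \<le> (\<Sum>A\<in>P. m)" using card_le by (rule sum_mono)
  finally show ?thesis using cd by simp
qed

lemma finite_sizes: "finite {size F | F. uniquely_resolvable n m F}"
proof (rule finite_subset)
  show "{size F | F. uniquely_resolvable n m F} \<subseteq> {..n * m}"
    using size_le_if_uniquely_resolvable by blast
qed simp

end

theory Submission
  imports Defs
begin

text \<open>Upper bound: the nontrivial unions of members of a class are distinct from those of every
  other class, so \<open>\<Sum>(2 ^ k\<^sub>i - 2) \<le> 2 ^ m - 2\<close> for the class sizes \<open>k\<^sub>i\<close>, and \<open>2 ^ k - 2 \<ge> 4 * k - 6\<close>.

  Lower bound: take \<open>r\<close> triples consisting of a nonempty \<open>S \<subseteq> {1..<h}\<close> with \<open>h = m div 2\<close>, its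
  translate by \<open>h\<close>, and the remaining points, and add complementary pairs of all other sets (except
  one pair, if parity demands it). A count shows that every resolution consists of complementary
  pairs and of triples among the members of the given triples; the member of such a triple
  containing \<open>m\<close> determines the other two.\<close>

section \<open>Numerical and partition-theoretic preliminaries\<close>

text \<open>This is the secant of \<open>2 ^ k\<close> through \<open>k = 2\<close> and
  \<open>k = 3\<close>, hence tight exactly at the class sizes that the extremal construction
  uses.\<close>

lemma two_power_ge: "4 * k \<le> 2 ^ k + (4 :: nat)"
proof (induction k)
  case (Suc k)
  show ?case
  proof (cases "k \<le> 1")
    case True
    then have "k = 0 \<or> k = 1" by linarith
    then show ?thesis by auto
  next
    case False
    then have "(2::nat) ^ 2 \<le> 2 ^ k" by (intro power_increasing) auto
    then show ?thesis using Suc by simp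
  qed
qed simp

text \<open>Every block of \<open>R\<close> meets a block of \<open>Q\<close>, which is itself a
  block of \<open>R\<close> and so coincides with it. Uniqueness of a partition thus needs only one
  inclusion.\<close>

lemma partition_on_subset_eq:
  assumes "partition_on H Q" "partition_on H R" "Q \<subseteq> R"
  shows "Q = R"
proof (rule antisym[OF assms(3)], rule subsetI)
  fix A assume A: "A \<in> R"
  then obtain x where x: "x \<in> A" "x \<in> H"
    using assms(2) by (metis all_not_in_conv partition_onD1 partition_onD3 UnionI)
  then obtain B where B: "B \<in> Q" "x \<in> B" using assms(1) by (auto simp: partition_on_def)
  then have "A = B"
    using A x assms(2,3) unfolding partition_on_def disjoint_def by blast
  then show "A \<in> Q" using B by simp
qed

text \<open>As \<open>S\<close> and \<open>U\<close> are proper and nonempty, each of the two new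
  blocks meets both \<open>A\<close> and \<open>B\<close>, so neither occurs in \<open>P\<close>.
  This preserves the number of blocks and forces a different partition.\<close>

lemma partition_on_swap:
  assumes P: "partition_on I P" and A: "A \<in> P" and B: "B \<in> P" and AB: "A \<noteq> B"
    and S: "S \<subset> A" "S \<noteq> {}" and U: "U \<subset> B" "U \<noteq> {}" and fin: "finite P"
  defines "P' \<equiv> insert (A - S \<union> U) (insert (B - U \<union> S) (P - {A, B}))"
  shows "partition_on I P'" "card P' = card P" "P' \<noteq> P"
proof -
  have dis: "X \<inter> Y = {}" if "X \<in> P" "Y \<in> P" "X \<noteq> Y" for X Y
    using P that by (auto simp: partition_on_def disjoint_def)
  have AB0: "A \<inter> B = {}" using dis A B AB by blast
  have new: "X \<inter> A = {}" "X \<inter> B = {}" if "X \<in> P - {A, B}" for X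
    using dis A B that by auto
  have ne: "A - S \<union> U \<noteq> {}" "B - U \<union> S \<noteq> {}" using S U by auto
  have AB': "(A - S \<union> U) \<inter> (B - U \<union> S) = {}" using AB0 S U by blast
  have notin: "A - S \<union> U \<notin> P"
  proof
    assume "A - S \<union> U \<in> P"
    moreover have "(A - S \<union> U) \<inter> A \<noteq> {}" "(A - S \<union> U) \<inter> B \<noteq> {}" using S U by auto
    ultimately show False using dis A B AB by metis
  qed
  have notin': "B - U \<union> S \<notin> P"
  proof
    assume "B - U \<union> S \<in> P"
    moreover have "(B - U \<union> S) \<inter> A \<noteq> {}" "(B - U \<union> S) \<inter> B \<noteq> {}" using S U by auto
    ultimately show False using dis A B AB by metis
  qed
  have neq: "A - S \<union> U \<noteq> B - U \<union> S" using AB' ne by auto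
  show "P' \<noteq> P" using notin unfolding P'_def by blast
  have "card P' = Suc (Suc (card (P - {A, B})))"
    using notin notin' neq fin unfolding P'_def by simp
  also have "card (P - {A, B}) = card P - 2"
    using A B AB by (subst card_Diff_subset) auto
  also have "card P \<ge> 2"
    using card_mono[OF fin, of "{A, B}"] A B AB by simp
  then have "Suc (Suc (card P - 2)) = card P" by simp
  finally show "card P' = card P" .
  show "partition_on I P'"
  proof (rule partition_onI)
    have "\<Union>P' = (A \<union> B) \<union> \<Union>(P - {A, B})" using S(1) U(1) unfolding P'_def by blast
    also have "\<dots> = \<Union>P" using A B by blast
    finally show "\<Union>P' = I" using P by (simp add: partition_on_def)
    show "{} \<notin> P'" using ne P unfolding P'_def partition_on_def by auto
    fix X Y assume XY: "X \<in> P'" "Y \<in> P'" "X \<noteq> Y"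
    have sub: "A - S \<union> U \<subseteq> A \<union> B" "B - U \<union> S \<subseteq> A \<union> B" using S(1) U(1) by blast+
    have new': "Z \<inter> (A - S \<union> U) = {}" "Z \<inter> (B - U \<union> S) = {}" if "Z \<in> P - {A, B}" for Z
      using new[OF that] sub by blast+
    have "X \<inter> Y = {}"
    proof (cases "X \<in> P - {A, B}")
      case True
      then show ?thesis using XY(2,3) new'[OF True] dis[of X Y] unfolding P'_def by blast
    next
      case X: False
      show ?thesis
      proof (cases "Y \<in> P - {A, B}")
        case True
        moreover have "X = A - S \<union> U \<or> X = B - U \<union> S" using XY(1) X unfolding P'_def by blast
        ultimately show ?thesis using new'[of Y] by blast
      next
        case False
        then have "Y = A - S \<union> U \<or> Y = B - U \<union> S" using XY(2) unfolding P'_def by blast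
        moreover have "X = A - S \<union> U \<or> X = B - U \<union> S" using XY(1) X unfolding P'_def by blast
        ultimately show ?thesis using AB' XY(3) by blast
      qed
    qed
    then show "disjnt X Y" by (simp add: disjnt_def)
  qed
qed

section \<open>Upper bound: unions of subfamilies of the classes\<close>

text \<open>A subfamily can be read off from its union: its indices are those \<open>j\<close> with
  \<open>C j\<close> inside the union, because a nonempty \<open>C j\<close> meets no other
  member.\<close>

lemma disjoint_family_on_union_inj:
  assumes "disjoint_family_on C A" "\<And>j. j \<in> A \<Longrightarrow> C j \<noteq> {}"
  shows "inj_on (\<lambda>S. \<Union>(C ` S)) (Pow A)"
proof -
  have *: "S = {j \<in> A. C j \<subseteq> \<Union>(C ` S)}" if S: "S \<subseteq> A" for S
  proof (intro equalityI subsetI)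
    fix j assume j: "j \<in> {j \<in> A. C j \<subseteq> \<Union>(C ` S)}"
    then obtain x where x: "x \<in> C j" using assms(2) by blast
    then obtain i where i: "i \<in> S" "x \<in> C i" using j by blast
    then have "i = j" using x j S assms(1) unfolding disjoint_family_on_def by auto
    then show "j \<in> S" using i by simp
  qed (use S in auto)
  show ?thesis
  proof (rule inj_onI)
    fix S S' assume S: "S \<in> Pow A" "S' \<in> Pow A" and eq: "\<Union>(C ` S) = \<Union>(C ` S')"
    have "S = {j \<in> A. C j \<subseteq> \<Union>(C ` S')}" using *[of S] S(1) unfolding eq by blast
    also have "\<dots> = S'" using *[of S'] S(2) by blast
    finally show "S = S'" .
  qed
qed

lemma card_Pow_proper:
  assumes "finite V" "V \<noteq> {}"
  shows "card (Pow V - {{}, V}) = 2 ^ card V - 2"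
  using assms by (subst card_Diff_subset) (auto simp: card_Pow)

text \<open>If two classes had a common nontrivial subunion, exchanging it would give another
  resolution.\<close>

lemma uniquely_resolvable_size_le:
  assumes ur: "uniquely_resolvable n m F" and m: "1 \<le> m"
  shows "4 * size F + 2 \<le> 2 ^ m + 6 * n"
proof -
  let ?I = "{1..size F}" and ?V = "{1..m}"
  have ne: "\<forall>X\<in>#F. X \<noteq> {}"
    and ex: "\<exists>C. indexing F C \<and> (\<exists>!P. resolution n m (size F) C P)"
    using ur by (simp_all add: uniquely_resolvable_def)
  obtain C where "indexing F C \<and> (\<exists>!P. resolution n m (size F) C P)"
    using ex by (rule exE)
  then have C: "indexing F C" and ex1: "\<exists>!P. resolution n m (size F) C P"
    by simp_all
  obtain P where P: "resolution n m (size F) C P"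
    and uq: "\<And>Q. resolution n m (size F) C Q \<Longrightarrow> Q = P"
    using ex1 by (metis (no_types))
  have part: "partition_on ?I P" and cd: "card P = n"
    and dis: "\<And>A. A \<in> P \<Longrightarrow> disjoint_family_on C A"
    and un: "\<And>A. A \<in> P \<Longrightarrow> (\<Union>j\<in>A. C j) = ?V"
    using P by (auto simp: resolution_def)
  have C_ne: "C i \<noteq> {}" if "i \<in> ?I" for i
  proof -
    have "C i \<in># image_mset C (mset_set ?I)" using that by simp
    then show ?thesis using ne C unfolding indexing_def by metis
  qed
  have sub: "A \<subseteq> ?I" if "A \<in> P" for A using that part by (auto simp: partition_on_def)
  have finA: "finite A" if "A \<in> P" for A using sub[OF that] by (rule finite_subset) simp
  have finP: "finite P" using part by (rule finite_elements[rotated]) simp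
  have Ane: "A \<noteq> {}" if "A \<in> P" for A using that part by (auto simp: partition_on_def)
  have inj: "inj_on (\<lambda>S. \<Union>(C ` S)) (Pow A)" if "A \<in> P" for A
    using disjoint_family_on_union_inj[OF dis[OF that]] C_ne sub[OF that] by blast
  \<comment> \<open>The unions of nontrivial subfamilies of \<open>A\<close>: if two classes shared
    one, they could exchange the corresponding subfamilies.\<close>
  define W where "W A = (\<lambda>S. \<Union>(C ` S)) ` (Pow A - {{}, A})" for A
  have cW: "card (W A) + 2 = 2 ^ card A" if A: "A \<in> P" for A
  proof -
    have "card (W A) = card (Pow A - {{}, A})"
      unfolding W_def by (rule card_image, rule inj_on_subset[OF inj[OF A]]) auto
    also have "\<dots> = 2 ^ card A - 2"
      using finA[OF A] Ane[OF A] by (rule card_Pow_proper)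
    finally have "card (W A) = 2 ^ card A - 2" .
    moreover have "card A \<ge> 1" using finA[OF A] Ane[OF A] by (simp add: Suc_leI card_gt_0_iff)
    then have "(2::nat) ^ 1 \<le> 2 ^ card A" by (intro power_increasing) auto
    ultimately show ?thesis by simp
  qed
  have Wsub: "W A \<subseteq> Pow ?V - {{}, ?V}" if A: "A \<in> P" for A
  proof
    fix X assume "X \<in> W A"
    then obtain S where S: "S \<subseteq> A" "S \<noteq> {}" "S \<noteq> A" and X: "X = \<Union>(C ` S)"
      unfolding W_def by blast
    \<comment> \<open>Injectivity on all of \<open>Pow A\<close> separates this union from those of
      \<open>{}\<close> and \<open>A\<close>, which are the empty set and the ground set.\<close>
    have "X \<noteq> \<Union>(C ` {})" "X \<noteq> \<Union>(C ` A)"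
      using inj_onD[OF inj[OF A], of S "{}"] inj_onD[OF inj[OF A], of S A] S X by auto
    moreover have "X \<subseteq> \<Union>(C ` A)" using S X by blast
    ultimately show "X \<in> Pow ?V - {{}, ?V}" using un[OF A] by auto
  qed
  have Wdis: "W A \<inter> W B = {}" if A: "A \<in> P" and B: "B \<in> P" and AB: "A \<noteq> B" for A B
  proof (rule ccontr)
    assume "W A \<inter> W B \<noteq> {}"
    then obtain S U where S: "S \<subset> A" "S \<noteq> {}" and U: "U \<subset> B" "U \<noteq> {}"
      and eq: "\<Union>(C ` S) = \<Union>(C ` U)"
      unfolding W_def by blast
    \<comment> \<open>This treats one of the two modified classes and is applied twice with the
      roles interchanged. A member left in \<open>X\<close> avoids every member of
      \<open>S'\<close>, hence the common union, hence every member of \<open>U'\<close>.\<close>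
    have exch: "disjoint_family_on C (X - S' \<union> U') \<and> \<Union>(C ` (X - S' \<union> U')) = ?V"
      if "X \<in> P" "Y \<in> P" "S' \<subseteq> X" "U' \<subseteq> Y" and eq': "\<Union>(C ` S') = \<Union>(C ` U')"
      for X Y S' U'
    proof
      have d: "C i \<inter> C j = {}" if "i \<in> X - S'" "j \<in> U'" for i j
      proof -
        have "C i \<inter> C k = {}" if k: "k \<in> S'" for k
        proof -
          have "i \<noteq> k" "i \<in> X" "k \<in> X" using k \<open>i \<in> X - S'\<close> \<open>S' \<subseteq> X\<close> by auto
          then show ?thesis using dis[OF \<open>X \<in> P\<close>] by (simp add: disjoint_family_on_def)
        qed
        then have "C i \<inter> \<Union>(C ` U') = {}" unfolding eq'[symmetric] by blast
        then show ?thesis using that by blast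
      qed
      show "disjoint_family_on C (X - S' \<union> U')"
        using d dis[OF \<open>X \<in> P\<close>] dis[OF \<open>Y \<in> P\<close>] \<open>U' \<subseteq> Y\<close>
        unfolding disjoint_family_on_def by (smt (verit) DiffD1 Int_commute Un_iff subsetD)
      have "\<Union>(C ` (X - S' \<union> U')) = \<Union>(C ` (X - S')) \<union> \<Union>(C ` S')" using eq' by auto
      also have "\<dots> = \<Union>(C ` X)" using \<open>S' \<subseteq> X\<close> by auto
      finally show "\<Union>(C ` (X - S' \<union> U')) = ?V" using un[OF \<open>X \<in> P\<close>] by simp
    qed
    let ?P' = "insert (A - S \<union> U) (insert (B - U \<union> S) (P - {A, B}))"
    have "resolution n m (size F) C ?P'"
      unfolding resolution_def
      using partition_on_swap[OF part A B AB S U finP] cd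
        exch[OF A B psubset_imp_subset[OF S(1)] psubset_imp_subset[OF U(1)] eq]
        exch[OF B A psubset_imp_subset[OF U(1)] psubset_imp_subset[OF S(1)] eq[symmetric]]
        dis un by auto
    then show False using uq partition_on_swap(3)[OF part A B AB S U finP] by blast
  qed
  have finW: "finite (W A)" if "A \<in> P" for A
    using Wsub[OF that] by (rule finite_subset) simp
  have "(\<Sum>A\<in>P. card (W A)) = card (\<Union>A\<in>P. W A)"
    using finP finW Wdis by (subst card_UN_disjoint) auto
  also have "\<dots> \<le> card (Pow ?V - {{}, ?V})"
    using Wsub by (intro card_mono) auto
  also have "\<dots> = 2 ^ m - 2" using card_Pow_proper[of ?V] m by simp
  finally have W: "(\<Sum>A\<in>P. card (W A)) + 2 \<le> 2 ^ m"
    using power_increasing[of 1 m "2::nat"] m by simp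
  have "size F = (\<Sum>A\<in>P. card A)"
    using product_partition[OF part finA] by simp
  then have "4 * size F = (\<Sum>A\<in>P. 4 * card A)" by (simp add: sum_distrib_left)
  also have "\<dots> \<le> (\<Sum>A\<in>P. card (W A) + 6)"
  proof (rule sum_mono)
    show "4 * card A \<le> card (W A) + 6" if "A \<in> P" for A
      using two_power_ge[of "card A"] cW[OF that] by linarith
  qed
  also have "\<dots> = (\<Sum>A\<in>P. card (W A)) + 6 * n" by (simp add: sum.distrib cd)
  finally show ?thesis using W by simp
qed

section \<open>Unique resolvability through partitions of a family of distinct sets\<close>

lemma image_image_id:
  assumes "\<And>x. x \<in> A \<Longrightarrow> f' (f x) = x"
  shows "f' ` f ` A = A"
  using image_cong[OF refl assms, of A] by (simp add: image_image)

text \<open>As the members of \<open>H\<close> are distinct, an indexing is a bijection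
  \<open>C\<close>. Images under \<open>C\<close> and its inverse translate resolutions of the index
  set into partitions of \<open>H\<close> and back, so uniqueness can be checked on \<open>H\<close>
  itself.\<close>

lemma uniquely_resolvable_mset_set:
  assumes fin: "finite H" and sub: "\<And>X. X \<in> H \<Longrightarrow> X \<noteq> {} \<and> X \<subseteq> {1..m}"
    and Q: "partition_on H Q" "card Q = n" "\<And>A. A \<in> Q \<Longrightarrow> partition_on {1..m} A"
    and uq: "\<And>R. partition_on H R \<Longrightarrow> card R = n \<Longrightarrow>
      (\<And>A. A \<in> R \<Longrightarrow> partition_on {1..m} A) \<Longrightarrow> R = Q"
  shows "uniquely_resolvable n m (mset_set H)"
proof -
  let ?t = "card H"
  let ?I = "{1..?t}"
  obtain C where C: "bij_betw C ?I H"
    using finite_same_card_bij[of ?I H] fin by auto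
  let ?D = "the_inv_into ?I C"
  have D: "bij_betw ?D H ?I" using C by (rule bij_betw_the_inv_into)
  have injC: "inj_on C ?I" and imC: "C ` ?I = H" and injD: "inj_on ?D H" and imD: "?D ` H = ?I"
    using C D by (auto simp: bij_betw_def)
  have CD: "C (?D X) = X" if "X \<in> H" for X using that C by (metis bij_betw_def f_the_inv_into_f)
  have DC: "?D (C i) = i" if "i \<in> ?I" for i using that injC by (simp add: the_inv_into_f_f)
  have ix: "indexing (mset_set H) C"
    unfolding indexing_def using injC imC by (simp add: image_mset_mset_set)
  have inj_img: "inj_on ((`) f) R" if "inj_on f J" "partition_on J R"
    for f :: "'x \<Rightarrow> 'y" and J R
    by (rule inj_on_subset[OF inj_on_image_Pow[OF that(1)]])
      (use that(2) in \<open>auto simp: partition_on_def\<close>)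
  have img: "partition_on (f ` J) ((`) f ` R)" if "inj_on f J" "partition_on J R"
    for f :: "'x \<Rightarrow> 'y" and J R
  proof -
    have "{} \<notin> (`) f ` R" using that(2) by (auto simp: partition_on_def)
    then show ?thesis using partition_on_inj_image[OF that(2,1)] by simp
  qed
  \<comment> \<open>Injectivity of \<open>C\<close> turns indexed disjointness into disjointness of
    the set of members; nonempty members exclude \<open>{}\<close> as a block.\<close>
  have cls: "(disjoint_family_on C A \<and> (\<Union>j\<in>A. C j) = {1..m}) \<longleftrightarrow> partition_on {1..m} (C ` A)"
    if "A \<subseteq> ?I" for A
  proof -
    have "inj_on C A" using injC that by (rule inj_on_subset)
    then have "disjoint_family_on C A \<longleftrightarrow> disjoint (C ` A)"
      by (metis disjoint_family_on_disjoint_image disjoint_image_disjoint_family_on)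
    moreover have "{} \<notin> C ` A" using that sub imC by blast
    ultimately show ?thesis by (auto simp: partition_on_def)
  qed
  let ?P = "(`) ?D ` Q"
  have "resolution n m ?t C ?P"
    unfolding resolution_def
  proof (intro conjI ballI)
    show "partition_on ?I ?P" using img[OF injD Q(1)] imD by simp
    show "card ?P = n" using inj_img[OF injD Q(1)] Q(2) by (simp add: card_image)
  next
    fix A assume "A \<in> ?P"
    then obtain B where B: "B \<in> Q" "A = ?D ` B" by blast
    then have BH: "B \<subseteq> H" using Q(1) by (auto simp: partition_on_def)
    have "C ` A = B" unfolding B(2) by (rule image_image_id) (use BH CD in blast)
    moreover have "A \<subseteq> ?I" using image_mono[OF BH, of ?D] unfolding B(2) imD .
    ultimately show "disjoint_family_on C A" "(\<Union>j\<in>A. C j) = {1..m}"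
      using cls[of A] Q(3)[OF B(1)] by simp_all
  qed
  moreover have "P = ?P" if P: "resolution n m ?t C P" for P
  proof -
    have part: "partition_on ?I P" and cd: "card P = n" using P by (auto simp: resolution_def)
    have sI: "A \<subseteq> ?I" if "A \<in> P" for A using part that by (auto simp: partition_on_def)
    have "partition_on H ((`) C ` P)" using img[OF injC part] imC by simp
    moreover have "card ((`) C ` P) = n" using inj_img[OF injC part] cd by (simp add: card_image)
    moreover have "partition_on {1..m} A" if A: "A \<in> (`) C ` P" for A
    proof -
      obtain B where B: "B \<in> P" "A = C ` B" using A by blast
      then show ?thesis using P cls[OF sI[OF B(1)]] by (simp add: resolution_def)
    qed
    ultimately have "(`) C ` P = Q" by (rule uq)
    moreover have "?D ` C ` A = A" if "A \<in> P" for A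
      by (rule image_image_id) (use sI[OF that] DC in blast)
    then have "(`) ?D ` (`) C ` P = P" by (rule image_image_id)
    ultimately show "P = ?P" by simp
  qed
  ultimately have "\<exists>!P. resolution n m ?t C P" by blast
  then show ?thesis
    using uniquely_resolvable_iff[OF ix] sub fin by simp
qed

text \<open>Members of \<open>T\<close> lack their complement, so a class \<open>A\<close> satisfies
  \<open>card (A \<inter> T) \<le> 3 * (card A - 2)\<close>. Summed over all classes this is an equality, which leaves
  only complementary pairs outside \<open>T\<close> and triples inside \<open>T\<close>.\<close>

lemma unique_partition_pairs_trios:
  assumes V: "finite V" and sub: "\<And>X. X \<in> D \<union> \<Union>Tr \<Longrightarrow> X \<noteq> {} \<and> X \<subset> V"
    and D: "\<And>X. X \<in> D \<Longrightarrow> V - X \<in> D" and DT: "D \<inter> \<Union>Tr = {}"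
    and comp: "\<And>X. X \<in> \<Union>Tr \<Longrightarrow> V - X \<notin> D \<union> \<Union>Tr"
    and dis: "disjoint Tr" and c3: "\<And>A. A \<in> Tr \<Longrightarrow> card A = 3 \<and> partition_on V A"
    and trio: "\<And>A. A \<subseteq> \<Union>Tr \<Longrightarrow> card A = 3 \<Longrightarrow> partition_on V A \<Longrightarrow> A \<in> Tr"
    and n: "card D + 2 * card Tr = 2 * n"
  defines "Q \<equiv> (\<lambda>X. {X, V - X}) ` D \<union> Tr"
  shows "partition_on (D \<union> \<Union>Tr) Q" "card Q = n" "\<And>A. A \<in> Q \<Longrightarrow> partition_on V A"
    "\<And>R. partition_on (D \<union> \<Union>Tr) R \<Longrightarrow> card R = n \<Longrightarrow>
      (\<And>A. A \<in> R \<Longrightarrow> partition_on V A) \<Longrightarrow> R = Q"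
proof -
  let ?T = "\<Union>Tr"
  let ?H = "D \<union> ?T"
  let ?P = "(\<lambda>X. {X, V - X}) ` D"
  have finH: "finite ?H" using sub V by (intro finite_subset[of ?H "Pow V"]) auto
  then have finD: "finite D" and finT: "finite ?T" and finTr: "finite Tr"
    by (auto dest: finite_UnionD)
  have UP: "\<Union>?P = D" using D by auto
  have cc: "V - (V - X) = X" if "X \<in> D" for X using sub that by blast
  have neX: "X \<noteq> V - X" if "X \<in> D" for X using sub that by blast
  have disP: "disjoint ?P"
  proof -
    \<comment> \<open>A pair is determined by either of its members, so overlapping pairs
      coincide.\<close>
    have *: "A = {W, V - W}" if "A \<in> ?P" "W \<in> A" for A W using that cc by auto
    have "A = B" if "A \<in> ?P" "B \<in> ?P" "W \<in> A" "W \<in> B" for A B W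
      using *[OF that(1,3)] *[OF that(2,4)] by simp
    then show ?thesis by (intro disjointI) (meson disjoint_iff)
  qed
  show part: "partition_on ?H Q"
  proof (rule partition_onI)
    show "\<Union>Q = ?H" unfolding Q_def using UP by simp
    show "{} \<notin> Q" using c3 unfolding Q_def by fastforce
    fix A B assume AB: "A \<in> Q" "B \<in> Q" "A \<noteq> B"
    have mixed: "A \<inter> B = {}" "B \<inter> A = {}" if "A \<in> ?P" "B \<in> Tr" for A B
    proof -
      have "A \<subseteq> D" "B \<subseteq> ?T" using that UP by blast+
      then show "A \<inter> B = {}" "B \<inter> A = {}" using DT by blast+
    qed
    have "A \<in> ?P \<or> A \<in> Tr" "B \<in> ?P \<or> B \<in> Tr" using AB(1,2) by (simp_all only: Q_def Un_iff)
    then show "disjnt A B"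
      unfolding disjnt_def
    proof (elim disjE)
      assume "A \<in> ?P" "B \<in> ?P"
      then show "A \<inter> B = {}" using AB(3) by (rule disjointD[OF disP])
    next
      assume "A \<in> Tr" "B \<in> Tr"
      then show "A \<inter> B = {}" using AB(3) by (rule disjointD[OF dis])
    qed (rule mixed; assumption)+
  qed
  have "2 * card ?P = card (\<Union>?P)"
  proof (rule card_partition)
    show "finite (\<Union>?P)" using finD UP by simp
    show "card A = 2" if "A \<in> ?P" for A using that neX by auto
    show "A \<inter> B = {}" if "A \<in> ?P" "B \<in> ?P" "A \<noteq> B" for A B using disP that by (rule disjointD)
  qed (use finD in simp)
  then have "2 * card ?P = card D" using UP by simp
  moreover have "card Q = card ?P + card Tr"
    unfolding Q_def
  proof (rule card_Un_disjoint)
    show "?P \<inter> Tr = {}" using DT by blast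
  qed (use finD finTr in auto)
  ultimately show cQ: "card Q = n" using n by simp
  have cT: "3 * card Tr = card ?T"
    using finTr finT c3 dis by (intro card_partition) (auto dest: disjointD)
  show "partition_on V A" if "A \<in> Q" for A
  proof -
    have "partition_on V {X, V - X}" if "X \<in> D" for X
      using sub[of X] that by (intro partition_onI) (auto simp: disjnt_def)
    then show ?thesis using that c3 unfolding Q_def by auto
  qed
  fix R assume R: "partition_on ?H R" "card R = n" "\<And>A. A \<in> R \<Longrightarrow> partition_on V A"
  have AH: "A \<subseteq> ?H" if "A \<in> R" for A using R(1) that by (auto simp: partition_on_def)
  have finA: "finite A" if "A \<in> R" for A using AH[OF that] finH by (rule finite_subset)
  have finR: "finite R" using R(1) finH by (rule finite_elements[rotated])
  have disR: "A \<inter> B = {}" if "A \<in> R" "B \<in> R" "A \<noteq> B" for A B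
    using R(1) that by (auto simp: partition_on_def disjoint_def)
  have pair: "A = {X, V - X}" if A: "A \<in> R" and c: "card A = 2" and X: "X \<in> A" for A X
  proof -
    have "card (A - {X}) = 1" using c X by simp
    then obtain Y where "A - {X} = {Y}" by (auto simp: card_1_singleton_iff)
    then have Y: "A = {X, Y}" "X \<noteq> Y" using X by blast+
    have "X \<union> Y = V" "X \<inter> Y = {}"
      using R(3)[OF A] Y by (auto simp: partition_on_def disjoint_def)
    then have "Y = V - X" by blast
    then show ?thesis using Y by simp
  qed
  have ge2: "2 \<le> card A" if A: "A \<in> R" for A
  proof (rule ccontr)
    assume "\<not> 2 \<le> card A"
    moreover have "A \<noteq> {}" using A R(1) by (auto simp: partition_on_def)
    then have "card A \<noteq> 0" using finA[OF A] by simp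
    ultimately have "card A = 1" by simp
    then obtain X where "A = {X}" by (auto simp: card_1_singleton_iff)
    then show False using R(3)[OF A] sub AH[OF A] by (auto simp: partition_on_def)
  qed
  \<comment> \<open>A class of size two is a complementary pair, so \<open>comp\<close> keeps it
    away from \<open>?T\<close> and both sides equal 6. From size three on,
    \<open>card A + 6 \<le> 3 * card A\<close> suffices.\<close>
  have le: "card (A \<inter> ?T) + 6 \<le> 3 * card A" if A: "A \<in> R" for A
  proof (cases "card A = 2")
    case True
    have "A \<inter> ?T = {}"
    proof (rule ccontr)
      assume "A \<inter> ?T \<noteq> {}"
      then obtain X where X: "X \<in> A" "X \<in> ?T" by blast
      then have "V - X \<in> A" using pair[OF A True] by blast
      then show False using comp[OF X(2)] AH[OF A] by blast
    qed
    then show ?thesis using True by simp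
  next
    case False
    then show ?thesis using ge2[OF A] card_mono[OF finA[OF A], of "A \<inter> ?T"] by simp
  qed
  have UR: "\<Union>R = ?H" using R(1) by (simp add: partition_on_def)
  have "(\<Sum>A\<in>R. card (A \<inter> ?T)) = card (\<Union>A\<in>R. A \<inter> ?T)"
    using finR finA disR by (subst card_UN_disjoint) auto
  also have "(\<Union>A\<in>R. A \<inter> ?T) = ?T" using UR by blast
  finally have sT: "(\<Sum>A\<in>R. card (A \<inter> ?T)) = 3 * card Tr" using cT by simp
  have "(\<Sum>A\<in>R. card A) = card (\<Union>R)"
    using product_partition[OF R(1) finA] UR by simp
  also have "\<dots> = card D + card ?T" using UR DT finD finT by (simp add: card_Un_disjoint)
  finally have "(\<Sum>A\<in>R. 3 * card A) = 3 * (card D + 3 * card Tr)"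
    using cT by (simp add: sum_distrib_left[symmetric])
  moreover have "(\<Sum>A\<in>R. card (A \<inter> ?T) + 6) = 3 * card Tr + 6 * n"
    using sT R(2) by (simp add: sum.distrib)
  \<comment> \<open>Hypothesis \<open>n\<close> makes both totals equal to
    \<open>3 * card Tr + 6 * n\<close>, so the inequality must be tight for every single
    class.\<close>
  ultimately have sums: "(\<Sum>A\<in>R. card (A \<inter> ?T) + 6) = (\<Sum>A\<in>R. 3 * card A)" using n by simp
  have eq: "card (A \<inter> ?T) + 6 = 3 * card A" if "A \<in> R" for A
    using sum_mono_inv[OF sums le that finR] .
  have "A \<in> Q" if A: "A \<in> R" for A
  proof -
    \<comment> \<open>Tightness together with \<open>card (A \<inter> ?T) \<le> card A\<close>
      forces \<open>card A \<le> 3\<close>.\<close>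
    have le': "card (A \<inter> ?T) \<le> card A" using finA[OF A] by (intro card_mono) auto
    then have "card A = 2 \<or> card A = 3" using eq[OF A] ge2[OF A] by linarith
    then show ?thesis
    proof
      assume c: "card A = 2"
      then have "card (A \<inter> ?T) = 0" using eq[OF A] by simp
      then have "A \<inter> ?T = {}" using finA[OF A] by simp
      moreover obtain X where X: "X \<in> A" using c by fastforce
      ultimately have "X \<in> D" using AH[OF A] by blast
      then show ?thesis using pair[OF A c X] unfolding Q_def by blast
    next
      assume c: "card A = 3"
      then have "card (A \<inter> ?T) = card A" using eq[OF A] by simp
      then have "A \<subseteq> ?T" using finA[OF A] by (metis card_subset_eq inf.absorb_iff1 inf_le1)
      then show ?thesis using trio[OF _ c R(3)[OF A]] unfolding Q_def by blast
    qed
  qed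
  then show "R = Q" using partition_on_subset_eq[OF R(1) part] by blast
qed

section \<open>Trios over two disjoint sides and a marked point\<close>

text \<open>Each \<open>S\<close> lies in the side \<open>L\<close> and has its partner
  \<open>b S\<close> in the side \<open>U\<close>; the point \<open>p\<close> outside both marks the
  third member. The arguments below recognise a member by whether it contains \<open>p\<close> and,
  if not, by its side.\<close>

locale trios =
  fixes V L U :: "'a set" and p :: 'a and b :: "'a set \<Rightarrow> 'a set" and \<S> :: "'a set set"
  assumes finite_V: "finite V"
    and sub_V: "L \<subseteq> V" "U \<subseteq> V" "p \<in> V"
    and disj: "L \<inter> U = {}" "p \<notin> L" "p \<notin> U"
    and low: "\<And>S. S \<in> \<S> \<Longrightarrow> S \<subseteq> L" "\<And>S. S \<in> \<S> \<Longrightarrow> S \<noteq> {}"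
    and high: "\<And>S. S \<in> \<S> \<Longrightarrow> b S \<subseteq> U" "\<And>S. S \<in> \<S> \<Longrightarrow> b S \<noteq> {}"
    and inj_b: "inj_on b \<S>"
begin

definition rest :: "'a set \<Rightarrow> 'a set" where
  "rest S = V - (S \<union> b S)"

definition trio :: "'a set \<Rightarrow> 'a set set" where
  "trio S = {S, b S, rest S}"

text \<open>Disjointness of the sides lets \<open>S\<close> be recovered from
  \<open>S \<union> b S\<close>, so that \<open>rest S\<close> alone determines its trio.\<close>

lemma Un_b_recover:
  assumes "S \<in> \<S>"
  shows "L \<inter> (S \<union> b S) = S" "U \<inter> (S \<union> b S) = b S" "V - rest S = S \<union> b S"
proof -
  note * = low(1)[OF assms] high(1)[OF assms] disj(1) sub_V(1,2)
  show "L \<inter> (S \<union> b S) = S" "U \<inter> (S \<union> b S) = b S" using * by blast+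
  have "S \<union> b S \<subseteq> V" using * by blast
  then show "V - rest S = S \<union> b S" unfolding rest_def by blast
qed

lemma p_mem:
  assumes "S \<in> \<S>"
  shows "p \<notin> S" "p \<notin> b S" "p \<in> rest S"
  using low(1)[OF assms] high(1)[OF assms] disj(2,3) sub_V(3) unfolding rest_def by blast+

lemma trio_rest:
  assumes "S \<in> \<S>" "X \<in> trio S" "p \<in> X"
  shows "X = rest S"
  using assms(2,3) p_mem[OF assms(1)] unfolding trio_def by auto

lemma trio_cases:
  assumes "S \<in> \<S>" "X \<in> trio S" "p \<notin> X"
  shows "X \<subseteq> L \<and> X = S \<or> X \<subseteq> U \<and> X = b S"
  using assms(2,3) p_mem[OF assms(1)] low(1)[OF assms(1)] high(1)[OF assms(1)]
  unfolding trio_def by auto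

lemma trio_sub:
  assumes "S \<in> \<S>" "X \<in> trio S"
  shows "X \<noteq> {}" "X \<subset> V"
proof -
  note * = low[OF assms(1)] high[OF assms(1)] sub_V p_mem[OF assms(1)]
  have "S \<subset> V" "b S \<subset> V" using * by blast+
  moreover have "rest S \<subset> V" using *(2) \<open>S \<subset> V\<close> unfolding rest_def by blast
  moreover have "rest S \<noteq> {}" using *(10) by blast
  ultimately show "X \<noteq> {}" "X \<subset> V" using assms(2) *(2,4) unfolding trio_def by auto
qed

lemma L_U_disjoint: "X \<subseteq> L \<Longrightarrow> X \<subseteq> U \<Longrightarrow> X = {}"
  using disj(1) by blast

text \<open>A member containing \<open>p\<close> is a \<open>rest S\<close>, which determines
  \<open>S\<close>. A member without \<open>p\<close> is nonempty and hence lies on one side only;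
  it is either \<open>S\<close> itself or determines \<open>S\<close> by injectivity of
  \<open>b\<close>.\<close>

lemma trio_unique:
  assumes S: "S \<in> \<S>" "S' \<in> \<S>" and X: "X \<in> trio S" "X \<in> trio S'"
  shows "S = S'"
proof (cases "p \<in> X")
  case True
  then have "rest S = rest S'" using trio_rest[OF S(1) X(1)] trio_rest[OF S(2) X(2)] by simp
  then show ?thesis using Un_b_recover S by metis
next
  case False
  have "X \<noteq> {}" using trio_sub(1)[OF S(1) X(1)] .
  then show ?thesis
    using trio_cases[OF S(1) X(1) False] trio_cases[OF S(2) X(2) False] L_U_disjoint
      inj_onD[OF inj_b _ S] by auto
qed

lemma card_trio:
  assumes "S \<in> \<S>"
  shows "card (trio S) = 3"
proof -
  have "S \<noteq> b S" using L_U_disjoint low[OF assms] high[OF assms] by auto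
  moreover have "S \<noteq> rest S" "b S \<noteq> rest S" using p_mem[OF assms] by auto
  ultimately show ?thesis unfolding trio_def by simp
qed

lemma partition_on_trio:
  assumes "S \<in> \<S>"
  shows "partition_on V (trio S)"
proof (rule partition_onI)
  have sub: "S \<union> b S \<subseteq> V" using Un_b_recover(3)[OF assms] by blast
  then show "\<Union>(trio S) = V" unfolding trio_def rest_def by blast
  show "{} \<notin> trio S" using trio_sub(1)[OF assms] by blast
  have "S \<inter> b S = {}" using low(1)[OF assms] high(1)[OF assms] disj(1) by blast
  moreover have "S \<inter> rest S = {}" "b S \<inter> rest S = {}" unfolding rest_def by blast+
  ultimately show "disjnt X Y" if "X \<in> trio S" "Y \<in> trio S" "X \<noteq> Y" for X Y
    using that unfolding trio_def disjnt_def by (auto simp del: Int_iff simp: Int_commute)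
qed

text \<open>One of \<open>X\<close> and \<open>V - X\<close> contains \<open>p\<close>. If both were
  members, that one would be some \<open>rest S\<close>, whose complement
  \<open>S \<union> b S\<close> meets both sides, while a member without \<open>p\<close> is
  confined to one.\<close>

lemma trio_compl:
  assumes X: "X \<in> \<Union>(trio ` \<S>)"
  shows "V - X \<notin> \<Union>(trio ` \<S>)"
proof -
  have *: False if S: "S \<in> \<S>" "Y \<in> trio S" "p \<in> Y" and S': "S' \<in> \<S>" "V - Y \<in> trio S'" for S S' Y
  proof -
    have "V - Y = S \<union> b S" using trio_rest[OF S] Un_b_recover(3)[OF S(1)] by simp
    moreover have "V - Y \<subseteq> L \<or> V - Y \<subseteq> U" using trio_cases[OF S'] S(3) by blast
    ultimately show False
      using L_U_disjoint[of S] L_U_disjoint[of "b S"] low[OF S(1)] high[OF S(1)] by auto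
  qed
  obtain S where S: "S \<in> \<S>" "X \<in> trio S" using X by blast
  have XX: "V - (V - X) = X" using trio_sub(2)[OF S] by blast
  show ?thesis
  proof
    assume "V - X \<in> \<Union>(trio ` \<S>)"
    then obtain S' where S': "S' \<in> \<S>" "V - X \<in> trio S'" by blast
    show False
    proof (cases "p \<in> X")
      case True
      then show False using * S S' by blast
    next
      case False
      then have "p \<in> V - X" using sub_V(3) by simp
      then show False using *[OF S' _ S(1)] S(2) XX by simp
    qed
  qed
qed

text \<open>Exactly one block contains \<open>p\<close>, and it is some \<open>rest S\<close>. The
  other two blocks each lie on one side and together cover \<open>S \<union> b S\<close>; since this
  meets both sides, they lie on different sides and are its traces there.\<close>

lemma trio_only:
  assumes A: "A \<subseteq> \<Union>(trio ` \<S>)" "card A = 3" "partition_on V A"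
  shows "A \<in> trio ` \<S>"
proof -
  obtain Z where Z: "Z \<in> A" "p \<in> Z" using partition_onD1[OF A(3)] sub_V(3) by blast
  then obtain S where S: "S \<in> \<S>" "Z \<in> trio S" using A(1) by blast
  then have Z_rest: "Z = rest S" using trio_rest Z(2) by blast
  have "card (A - {Z}) = 2" using A(2) Z by simp
  then obtain X Y where XY: "A - {Z} = {X, Y}" "X \<noteq> Y" by (auto simp: card_2_iff)
  have AX: "A = insert Z {X, Y}" using XY(1) Z(1) by blast
  have XYZ: "X \<noteq> Z" "Y \<noteq> Z" "X \<in> A" "Y \<in> A" using XY(1) by blast+
  have dj: "Z \<inter> X = {}" "Z \<inter> Y = {}"
    using disjointD[OF partition_onD2[OF A(3)]] XYZ Z(1) by metis+
  have "X \<union> Y = V - Z" using partition_onD1[OF A(3)] dj unfolding AX by auto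
  then have XYu: "X \<union> Y = S \<union> b S" using Un_b_recover(3)[OF S(1)] Z_rest by simp
  have side: "W \<subseteq> L \<or> W \<subseteq> U" if W: "W \<in> A" "p \<notin> W" for W
  proof -
    obtain S' where "S' \<in> \<S>" "W \<in> trio S'" using W(1) A(1) by blast
    then show ?thesis using trio_cases W(2) by blast
  qed
  have "p \<notin> X" "p \<notin> Y" using dj Z(2) by blast+
  then have "X \<subseteq> L \<or> X \<subseteq> U" "Y \<subseteq> L \<or> Y \<subseteq> U" using side XYZ by blast+
  then have "{X, Y} = {S, b S}"
  proof (elim disjE)
    assume "X \<subseteq> L" "Y \<subseteq> L"
    then have "b S \<subseteq> L" using XYu by blast
    then show ?thesis using L_U_disjoint high[OF S(1)] by blast
  next
    assume "X \<subseteq> U" "Y \<subseteq> U"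
    then have "S \<subseteq> U" using XYu by blast
    then show ?thesis using L_U_disjoint low[OF S(1)] by blast
  next
    assume "X \<subseteq> L" "Y \<subseteq> U"
    then have "X = L \<inter> (X \<union> Y)" "Y = U \<inter> (X \<union> Y)" using disj(1) by blast+
    then show ?thesis unfolding XYu Un_b_recover(1,2)[OF S(1)] by simp
  next
    assume "X \<subseteq> U" "Y \<subseteq> L"
    then have "Y = L \<inter> (X \<union> Y)" "X = U \<inter> (X \<union> Y)" using disj(1) by blast+
    then show ?thesis unfolding XYu Un_b_recover(1,2)[OF S(1)] by (simp add: insert_commute)
  qed
  then have "A = trio S" unfolding AX Z_rest trio_def by (metis insert_commute)
  then show ?thesis using S(1) by blast
qed

lemma disjoint_trios: "disjoint (trio ` \<S>)"
proof -
  have "trio S \<inter> trio S' = {}" if "S \<in> \<S>" "S' \<in> \<S>" "trio S \<noteq> trio S'" for S S'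
    using trio_unique[OF that(1,2)] that(3) by blast
  then show ?thesis by (auto simp: disjoint_def simp del: Int_iff)
qed

lemma card_trios: "card (trio ` \<S>) = card \<S>"
proof (rule card_image, rule inj_onI)
  fix S S' assume S: "S \<in> \<S>" "S' \<in> \<S>" and eq: "trio S = trio S'"
  have "S \<in> trio S" by (simp add: trio_def)
  then show "S = S'" using trio_unique[OF S] unfolding eq by blast
qed

lemma finite_Union_trios: "finite (\<Union>(trio ` \<S>))"
proof (rule finite_subset)
  show "\<Union>(trio ` \<S>) \<subseteq> Pow V" using trio_sub(2) by blast
qed (simp add: finite_V)

lemma card_Union_trios: "card (\<Union>(trio ` \<S>)) = 3 * card \<S>"
proof -
  have "3 * card (trio ` \<S>) = card (\<Union>(trio ` \<S>))"
  proof (rule card_partition)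
    show "finite (trio ` \<S>)" using finite_UnionD[OF finite_Union_trios] .
    show "card A = 3" if "A \<in> trio ` \<S>" for A using that card_trio by auto
    show "A \<inter> B = {}" if "A \<in> trio ` \<S>" "B \<in> trio ` \<S>" "A \<noteq> B" for A B
      using disjoint_trios that by (rule disjointD)
  qed (rule finite_Union_trios)
  then show ?thesis using card_trios by simp
qed

end

section \<open>Lower bound: the construction\<close>

text \<open>There are \<open>2 ^ (m - 1) - 1\<close> complementary pairs of proper nonempty subsets.
  Each of \<open>r\<close> trios blocks three of them and supplies one class, and \<open>e\<close>
  further pairs are dropped for parity. This leaves \<open>n\<close> classes, with
  \<open>3 * r + 2 * (n - r)\<close> members. The bound on \<open>r\<close> is the number of
  available sets \<open>S\<close>.\<close>

lemma exists_uniquely_resolvable: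
  assumes m: "2 \<le> m" and n: "n + 2 * r + e = 2 ^ (m - 1) - 1" and e: "e \<le> 1"
    and r: "r \<le> 2 ^ (m div 2 - 1) - 1"
  shows "\<exists>F. uniquely_resolvable n m F \<and> size F = 2 * n + r"
proof -
  define h where "h = m div 2"
  define V where "V = {1..m}"
  have h: "1 \<le> h" "2 * h \<le> m" "h < m" using m unfolding h_def by auto
  have V: "finite V" "card V = m" "V \<noteq> {}" "m \<in> V" "h \<in> V" using m h unfolding V_def by auto
  have "card (Pow {1..<h} - {{}}) = 2 ^ (h - 1) - 1" by (simp add: card_Pow)
  then obtain \<S> where \<S>: "\<S> \<subseteq> Pow {1..<h} - {{}}" "card \<S> = r"
    using r obtain_subset_with_card_n unfolding h_def by metis
  \<comment> \<open>Stopping short of \<open>h\<close> and \<open>2 * h\<close> keeps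
    \<open>m\<close> outside both sides for even and odd \<open>m\<close> alike. The point
    \<open>h\<close> is outside too, so it belongs to every \<open>rest S\<close> and to no other
    member.\<close>
  interpret trios V "{1..<h}" "{h<..<2 * h}" m "(`) ((+) h)" \<S>
  proof
    show "(+) h ` S \<subseteq> {h<..<2 * h}" if "S \<in> \<S>" for S
      using that \<S>(1) by (auto dest!: subsetD)
    show "inj_on ((`) ((+) h)) \<S>"
      by (rule inj_onI) (simp add: inj_image_eq_iff)
  qed (use h \<S>(1) in \<open>auto simp: V_def\<close>)
  let ?T = "\<Union>(trio ` \<S>)"
  let ?N = "?T \<union> (-) V ` ?T"
  \<comment> \<open>The pair dropped when \<open>e = 1\<close>. It must avoid all trio members and
    their complements: in a trio member \<open>h\<close> and \<open>m\<close> occur together or not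
    at all, whereas \<open>{m}\<close> and its complement separate them.\<close>
  define E where "E = (if e = 0 then {} else {{m}, V - {m}})"
  define D where "D = Pow V - {{}, V} - (?N \<union> E)"
  have Tsub: "X \<noteq> {} \<and> X \<subset> V" if "X \<in> ?T" for X using that trio_sub by blast
  have dd: "V - (V - X) = X" if "X \<subseteq> V" for X using that by blast
  have dT: "V - (V - X) = X" if "X \<in> ?T" for X using dd Tsub[OF that] by blast
  have h_rest: "h \<in> X" if X: "X \<in> ?T" "m \<in> X" for X
  proof -
    obtain S where S: "S \<in> \<S>" "X = rest S" using X trio_rest by blast
    have "h \<notin> S \<union> (+) h ` S" using low(1)[OF S(1)] high(1)[OF S(1)] by auto
    then show ?thesis using V S(2) unfolding rest_def by simp
  qed
  have h_not: "h \<notin> X" if X: "X \<in> ?T" "m \<notin> X" for X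
  proof -
    obtain S where S: "S \<in> \<S>" "X \<in> trio S" using X(1) by blast
    show ?thesis using trio_cases[OF S X(2)] by auto
  qed
  have m_notin: "{m} \<notin> ?T" "V - {m} \<notin> ?T" using h_rest[of "{m}"] h_not[of "V - {m}"] h V by auto
  have EN: "?N \<inter> E = {}"
  proof -
    have "{m} \<noteq> V - X" "V - {m} \<noteq> V - X" if "X \<in> ?T" for X
      using that m_notin dT[OF that] dd[of "{m}"] V(4) by auto
    then have "{m} \<notin> ?N" "V - {m} \<notin> ?N" using m_notin by blast+
    then show ?thesis unfolding E_def by simp
  qed
  have "{m} \<noteq> V" "V - {m} \<noteq> {}" "V - {m} \<noteq> V" using h(3) V(4,5) by auto
  then have Esub: "E \<subseteq> Pow V - {{}, V}" using V(4) unfolding E_def by simp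
  have Nsub: "?N \<subseteq> Pow V - {{}, V}" using Tsub by blast
  have cN: "card ?N = 6 * r"
  proof -
    have "inj_on ((-) V) ?T" by (rule inj_onI) (metis dT)
    then have "card ((-) V ` ?T) = 3 * r" using card_Union_trios \<S>(2) by (simp add: card_image)
    moreover have "?T \<inter> (-) V ` ?T = {}" using trio_compl by blast
    ultimately show ?thesis
      using card_Union_trios \<S>(2) finite_Union_trios by (simp add: card_Un_disjoint)
  qed
  have "{m} \<noteq> V - {m}" by blast
  then have cE: "card E = 2 * e" using e unfolding E_def by auto
  have finE: "finite E" unfolding E_def by simp
  have cNE: "card (?N \<union> E) = 6 * r + 2 * e"
    using card_Un_disjoint[OF _ finE EN] finite_Union_trios cN cE by simp
  have cP: "card (Pow V - {{}, V}) = 2 * (2 ^ (m - 1) - 1)"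
    using card_Pow_proper[OF V(1,3)] V(2) power_minus_mult[of m "2::nat"] m by simp
  have NEsub: "?N \<union> E \<subseteq> Pow V - {{}, V}" using Nsub Esub by (rule Un_least)
  have "finite (?N \<union> E)" using finite_Union_trios finE by simp
  then have "card D = card (Pow V - {{}, V}) - card (?N \<union> E)"
    unfolding D_def using NEsub by (rule card_Diff_subset)
  \<comment> \<open>Needed so that the subtraction in the formula for \<open>card D\<close> is not
    truncated.\<close>
  moreover have "card (?N \<union> E) \<le> card (Pow V - {{}, V})"
    by (rule card_mono[OF _ NEsub]) (simp add: V(1))
  ultimately have "card D + 6 * r + 2 * e = 2 * (n + 2 * r + e)" unfolding cNE cP n by linarith
  then have cD: "card D + 2 * card (trio ` \<S>) = 2 * n" using card_trios \<S>(2) by simp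
  have D_compl: "V - X \<in> D" if X: "X \<in> D" for X
  proof -
    have X': "X \<subseteq> V" "X \<noteq> {}" "X \<noteq> V" "X \<notin> ?T" "X \<notin> (-) V ` ?T" "X \<notin> E"
      using X unfolding D_def by blast+
    have XX: "V - (V - X) = X" using dd X'(1) .
    have "V - X \<noteq> {}" "V - X \<noteq> V" using X'(1-3) by blast+
    moreover have "V - X \<notin> ?T" using X'(5) XX by (metis imageI)
    moreover have "V - X \<notin> (-) V ` ?T"
    proof
      assume "V - X \<in> (-) V ` ?T"
      then obtain Y where "Y \<in> ?T" "V - X = V - Y" by blast
      then show False using X'(4) XX dT by metis
    qed
    moreover have "V - X \<notin> E"
      using X'(6) XX dd[of "{m}"] V(4) unfolding E_def by (auto split: if_splits)
    ultimately show ?thesis unfolding D_def by blast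
  qed
  have DT: "D \<inter> ?T = {}" unfolding D_def by blast
  have DTsub: "X \<noteq> {} \<and> X \<subset> V" if "X \<in> D \<union> ?T" for X
    using that Tsub unfolding D_def by blast
  have compl: "V - X \<notin> D \<union> ?T" if "X \<in> ?T" for X
    using that trio_compl unfolding D_def by blast
  have trio3: "card A = 3 \<and> partition_on V A" if "A \<in> trio ` \<S>" for A
    using that card_trio partition_on_trio by blast
  note unique = unique_partition_pairs_trios[OF V(1) DTsub D_compl DT compl disjoint_trios trio3
      trio_only cD]
  have finH: "finite (D \<union> ?T)" using V(1) finite_Union_trios unfolding D_def by simp
  have "uniquely_resolvable n m (mset_set (D \<union> ?T))"
  proof (rule uniquely_resolvable_mset_set[OF finH])
    show "X \<noteq> {} \<and> X \<subseteq> {1..m}" if "X \<in> D \<union> ?T" for X using DTsub[OF that] unfolding V_def by blast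
    show "partition_on (D \<union> ?T) ((\<lambda>X. {X, V - X}) ` D \<union> trio ` \<S>)" by (rule unique(1))
    show "card ((\<lambda>X. {X, V - X}) ` D \<union> trio ` \<S>) = n" by (rule unique(2))
    show "partition_on {1..m} A" if "A \<in> (\<lambda>X. {X, V - X}) ` D \<union> trio ` \<S>" for A
      unfolding V_def[symmetric] by (rule unique(3)) (fact that | assumption)+
    show "R = (\<lambda>X. {X, V - X}) ` D \<union> trio ` \<S>"
      if "partition_on (D \<union> ?T) R" "card R = n" "\<And>A. A \<in> R \<Longrightarrow> partition_on {1..m} A" for R
      by (rule unique(4)) (fact that[folded V_def] | assumption)+
  qed
  moreover have "card (D \<union> ?T) = 2 * n + r"
    using cD DT finH card_trios card_Union_trios \<S>(2) by (simp add: card_Un_disjoint)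
  ultimately show ?thesis using finH by auto
qed

section \<open>The value of \<open>g\<close>\<close>

theorem theorem29:
  fixes n m :: nat
  assumes "4 \<le> m"
    and "2 ^ (m - 1) + 1 - 2 ^ (m div 2) \<le> n"
    and "n \<le> 2 ^ (m - 1) - 1"
  shows "g n m = 2 * n + (2 ^ (m - 1) - 1 - n) div 2"
proof -
  let ?N = "2 ^ (m - 1) - 1 :: nat"
  define r where "r = (?N - n) div 2"
  define e where "e = (?N - n) mod 2"
  have N2: "(2::nat) ^ m = 2 * 2 ^ (m - 1)"
    using power_minus_mult[of m "2::nat"] assms(1) by simp
  have h2: "(2::nat) ^ (m div 2) = 2 * 2 ^ (m div 2 - 1)"
    using power_minus_mult[of "m div 2" "2::nat"] assms(1) by simp
  have rn: "?N - n = 2 * r + e" "e \<le> 1" unfolding r_def e_def by auto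
  \<comment> \<open>The lower bound on \<open>n\<close> gives
    \<open>?N - n \<le> 2 ^ (m div 2) - 2\<close>; the second disjunct covers a zero difference.
    Halving leaves at most the number of nonempty subsets of \<open>{1..<m div 2}\<close>.\<close>
  have "2 * r + e + 2 \<le> 2 ^ (m div 2) \<or> 2 * r + e = 0"
    using assms(2) rn(1) by linarith
  then have r_le: "r \<le> 2 ^ (m div 2 - 1) - 1" unfolding h2 by linarith
  have "n + 2 * r + e = ?N" using assms(3) rn(1) by linarith
  then obtain F where F: "uniquely_resolvable n m F" "size F = 2 * n + r"
    using exists_uniquely_resolvable[of m n r e] assms(1) rn(2) r_le by fastforce
  \<comment> \<open>With \<open>?N = n + 2 * r + e\<close> the general bound reads
    \<open>4 * size F \<le> 8 * n + 4 * r + 2 * e\<close>. As \<open>e \<le> 1\<close>, the last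
    term is lost by integrality.\<close>
  have le: "size F \<le> 2 * n + r" if "uniquely_resolvable n m F" for F
    using uniquely_resolvable_size_le[OF that] assms(1,3) rn unfolding N2 by linarith
  have "g n m = 2 * n + r"
    unfolding g_def
  proof (rule Max_eqI[OF finite_sizes])
    show "k \<le> 2 * n + r" if "k \<in> {size F | F. uniquely_resolvable n m F}" for k
      using that le by blast
    show "2 * n + r \<in> {size F | F. uniquely_resolvable n m F}"
      using F by (metis (mono_tags, lifting) mem_Collect_eq)
  qed
  then show ?thesis unfolding r_def .
qed

end
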